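(* Let $\langle S, F\rangle$ be an $\mathcal{F}$-system and let $L: S\to\{\mathtt{T},\mathtt{F},\mathtt{U}\}$ be a total function. Then $L$ is a classical labelling on $\langle S,F\rangle$ if and only if the set $A=\{x\in S: L(x)=\mathtt{T}\}$ is a conglomerate of $\langle S,F\rangle$.
   Context: An $\mathcal{F}$-system is a pair $\langle S, F\rangle$ where $S$ is a set (its elements are primitive entities called sentences) and $F\subseteq S\times S$ is a binary relation. For $x\in S$ put $\overrightarrow{F}(x)=\{y\in S: (x,y)\in F\}$ and $\overleftarrow{F}(x)=\{y\in S:(y,x)\in F\}$; for $A\subseteq S$ put $\overrightarrow{F}(A)=\bigcup_{x\in A}\overrightarrow{F}(x)$ and $\overleftarrow{F}(A)=\bigcup_{x\in A}\overleftarrow{F}(x)$. A sentence $x$ is a sink if $\overrightarrow{F}(x)=\emptyset$, and $sinks(A)=\{x\in A: x\text{ is a sink}\}$. The three labels $\mathtt{T}$, $\mathtt{F}$, $\mathtt{U}$ stand for true, false and undetermined. A labelling on $\langle S,F\rangle$ is a total function $L:S\to\{\mathtt{T},\mathtt{F},\mathtt{U}\}$ such that for all $x\in S\setminus sinks(S)$: (a) $L(x)=\mathtt{F}$ iff $L(z)=\mathtt{T}$ for some $z\in\overrightarrow{F}(x)$; and (b) $L(x)=\mathtt{T}$ iff $L(z)=\mathtt{F}$ for every $z\in\overrightarrow{F}(x)$. (Labels of sinks are unrestricted.) A labelling $L$ is classical iff $L(x)\neq\mathtt{U}$ for every $x\in S$. A conglomerate of $\langle S,F\rangle$ is a subset $A\subseteq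 S$ such that (1) $\overleftarrow{F}(A)\subseteq S\setminus A$, and (2) $(S\setminus A)\setminus sinks(S)\subseteq\overleftarrow{F}(A)$.
   Formalization: The right-hand side also requires that L(x) is not U for every x in S; without this the converse fails, e.g. S={0}, F empty, L(0)=U, where A is empty and a conglomerate but L is not classical. *)

theory Defs
  imports Main
begin

definition f_system :: "'a set \<Rightarrow> ('a \<times> 'a) set \<Rightarrow> bool" where
  "f_system S F \<longleftrightarrow> F \<subseteq> S \<times> S"

definition out_nbrs :: "'a set \<Rightarrow> ('a \<times> 'a) set \<Rightarrow> 'a \<Rightarrow> 'a set" where
  "out_nbrs S F x = {y \<in> S. (x, y) \<in> F}"

definition in_nbrs :: "'a set \<Rightarrow> ('a \<times> 'a) set \<Rightarrow> 'a \<Rightarrow> 'a set" where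
  "in_nbrs S F x = {y \<in> S. (y, x) \<in> F}"

definition in_nbrs_set :: "'a set \<Rightarrow> ('a \<times> 'a) set \<Rightarrow> 'a set \<Rightarrow> 'a set" where
  "in_nbrs_set S F A = (\<Union>x\<in>A. in_nbrs S F x)"

definition sinks :: "'a set \<Rightarrow> ('a \<times> 'a) set \<Rightarrow> 'a set \<Rightarrow> 'a set" where
  "sinks S F A = {x \<in> A. out_nbrs S F x = {}}"

datatype label = LTrue | LFalse | LUndet

(* A labelling is a function on the whole type 'a; only its restriction to S matters,
   since every condition below quantifies over elements of S only. *)

definition labelling :: "'a set \<Rightarrow> ('a \<times> 'a) set \<Rightarrow> ('a \<Rightarrow> label) \<Rightarrow> bool" where
  "labelling S F L \<longleftrightarrow>
     (\<forall>x \<in> S - sinks S F S.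
        (L x = LFalse \<longleftrightarrow> (\<exists>z \<in> out_nbrs S F x. L z = LTrue)) \<and>
        (L x = LTrue \<longleftrightarrow> (\<forall>z \<in> out_nbrs S F x. L z = LFalse)))"

definition classical_labelling :: "'a set \<Rightarrow> ('a \<times> 'a) set \<Rightarrow> ('a \<Rightarrow> label) \<Rightarrow> bool" where
  "classical_labelling S F L \<longleftrightarrow> labelling S F L \<and> (\<forall>x \<in> S. L x \<noteq> LUndet)"

definition conglomerate :: "'a set \<Rightarrow> ('a \<times> 'a) set \<Rightarrow> 'a set \<Rightarrow> bool" where
  "conglomerate S F A \<longleftrightarrow>
     A \<subseteq> S \<and>
     in_nbrs_set S F A \<subseteq> S - A \<and>
     (S - A) - sinks S F S \<subseteq> in_nbrs_set S F A"

(* Whether {x \<in> S. L x = LTrue} is a conglomerate does not depend on how L distributes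
   LFalse and LUndet over the rest of S. Hence it does not by itself make L classical,
   nor even a labelling: the two lemmas below give an undetermined sink and an
   undetermined non-sink. *)

lemma conglomerate_not_classical:
  "f_system {0::nat} {} \<and>
   conglomerate {0::nat} {} {x \<in> {0}. (\<lambda>_. LUndet) x = LTrue} \<and>
   \<not> classical_labelling {0::nat} {} (\<lambda>_. LUndet)"
  by (auto simp: f_system_def conglomerate_def classical_labelling_def
      in_nbrs_set_def in_nbrs_def sinks_def out_nbrs_def)

lemma conglomerate_not_labelling:
  fixes S :: "nat set"
  defines "S \<equiv> {0, 1}" and "F \<equiv> {(0, 1)}" and "L \<equiv> (\<lambda>x. if x = 1 then LTrue else LUndet)"
  shows "f_system S F \<and> conglomerate S F {x \<in> S. L x = LTrue} \<and> \<not> labelling S F L"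
  by (auto simp: assms f_system_def conglomerate_def labelling_def
      in_nbrs_set_def in_nbrs_def sinks_def out_nbrs_def)

end

theory Submission
  imports Defs
begin

(* When no sentence is undetermined, both labelling clauses at a non-sink x say the same thing:
   x is not true iff it refers to a true sentence. The two inclusions defining a conglomerate are
   the two directions of this equivalence, since a sentence referring to a true one is
   automatically not a sink. *)

text \<open>Trades predecessors of \<open>A\<close> for a condition on successors, the form in which
  labellings are stated.\<close>

lemma in_nbrs_set_iff_out_nbrs:
  assumes "A \<subseteq> S"
  shows "x \<in> in_nbrs_set S F A \<longleftrightarrow> x \<in> S \<and> (\<exists>z \<in> out_nbrs S F x. z \<in> A)"
  using assms by (auto simp: in_nbrs_set_def in_nbrs_def out_nbrs_def)

lemma conglomerate_iff:
  "conglomerate S F A \<longleftrightarrow>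
     A \<subseteq> S \<and> (\<forall>x \<in> S - sinks S F S. x \<notin> A \<longleftrightarrow> (\<exists>z \<in> out_nbrs S F x. z \<in> A))"
proof (cases "A \<subseteq> S")
  case True
  \<comment> \<open>This lets the first inclusion, which ranges over all of \<open>S\<close>, be
    restricted to non-sinks.\<close>
  have "x \<notin> sinks S F S" if "z \<in> out_nbrs S F x" for x z
    using that by (auto simp: sinks_def)
  then show ?thesis
    unfolding conglomerate_def subset_iff Diff_iff in_nbrs_set_iff_out_nbrs[OF True] Ball_def
    using True by blast
qed (simp add: conglomerate_def)

lemma labelling_iff_if_determined:
  assumes "\<forall>x \<in> S. L x \<noteq> LUndet"
  shows "labelling S F L \<longleftrightarrow>
    (\<forall>x \<in> S - sinks S F S. L x \<noteq> LTrue \<longleftrightarrow> (\<exists>z \<in> out_nbrs S F x. L z = LTrue))"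
proof -
  have false_iff: "L x = LFalse \<longleftrightarrow> L x \<noteq> LTrue" if "x \<in> S" for x
    using assms that by (cases "L x") auto
  \<comment> \<open>Labels are known to be two-valued only on \<open>S\<close>.\<close>
  have out: "out_nbrs S F x \<subseteq> S" for x
    by (auto simp: out_nbrs_def)
  \<comment> \<open>So the clause for \<open>LTrue\<close> is the one for \<open>LFalse\<close> with
    both sides negated.\<close>
  have "(\<forall>z \<in> out_nbrs S F x. L z = LFalse) \<longleftrightarrow> \<not> (\<exists>z \<in> out_nbrs S F x. L z = LTrue)" for x
    using false_iff out by blast
  then show ?thesis
    unfolding labelling_def using false_iff by (metis DiffD1)
qed

theorem theorem1:
  fixes S :: "'a set" and F :: "('a \<times> 'a) set" and L :: "'a \<Rightarrow> label"
  assumes "f_system S F"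
  shows "classical_labelling S F L \<longleftrightarrow>
           conglomerate S F {x \<in> S. L x = LTrue} \<and> (\<forall>x \<in> S. L x \<noteq> LUndet)"
proof (cases "\<forall>x \<in> S. L x \<noteq> LUndet")
  case True
  \<comment> \<open>Removes the guard \<open>x \<in> S\<close> under the existential, so that the
    two characterizations coincide.\<close>
  have "z \<in> {x \<in> S. L x = LTrue} \<longleftrightarrow> L z = LTrue" if "z \<in> out_nbrs S F x" for x z
    using that by (simp add: out_nbrs_def)
  then show ?thesis
    using True
    by (simp add: classical_labelling_def labelling_iff_if_determined conglomerate_iff
        cong: bex_cong)
qed (auto simp: classical_labelling_def)

end
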